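(* Let $A$ be an alphabet (a set), and let $(X_n)_{n\in\mathbb N_0}$ be a family of subsets $X_n\subset A^n$. The following conditions are equivalent: (1) $(X_n)_{n\in\mathbb N_0}$ is a word system over $A$; (2) $(X_n)_{n\in\mathbb N_0}$ is a Cartesian subsystem of the full word system $(A^n)_{n\in\mathbb N_0}$ over $A$.
   Context: $A^n$ is the set of words of length $n$ over $A$ ($n$-tuples), $A^0=\{\Lambda\}$ with $\Lambda=()$ the empty word, and $A^*=\bigcup_{n\in\mathbb N_0}A^n$ is a monoid under concatenation. A word $y$ is a subword of $w$ if $w=xyz$ for some $x,z\in A^*$. A word system over $A$ is a family $(X_n)_{n\in\mathbb N_0}$ of subsets $X_n\subset A^n$ with $X_0=A^0$ such that whenever $w\in\bigcup_n X_n$ and $y\in A^k$ is a subword of $w$, then $y\in X_k$. A Cartesian system over $\mathbb N_0$ is a family $(X_n)_{n\in\mathbb N_0}$ of sets with $X_0=\{\Lambda\}$ a one-point set, together with injections $i_{m,n}\colon X_{m+n}\to X_m\times X_n$ ($m,n\in\mathbb N_0$) such that, for all $\ell,m,n\in\mathbb N_0$, $(i_{\ell,m}\times \mathrm{id}_{X_n})\circ i_{\ell+m,n}=(\mathrm{id}_{X_\ell}\times i_{m,n})\circ i_{\ell,m+n}$ as maps into $X_\ell\times X_m\times X_n$, and $i_{0,n}(x)=(\Lambda,x)$, $i_{n,0}(x)=(x,\Lambda)$ for all $x\in X_n$. A family $(Y_n)_{n\in\mathbb N_0}$ of subsets $Y_n\subset X_n$ with $Y_0=X_0$ is a Cartesian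 subsystem of $(X_n)$ if $i_{m,n}(Y_{m+n})\subset Y_m\times Y_n$ for all $m,n\in\mathbb N_0$. The full word system over $A$ is the Cartesian system $(A^n)_{n\in\mathbb N_0}$ whose maps $i_{m,n}\colon A^{m+n}\to A^m\times A^n$ are the inverses of the concatenation maps $A^m\times A^n\to A^{m+n}$, $(x,y)\mapsto xy$. *)

theory Defs
  imports Main
begin

text \<open>
  Words over an alphabet \<open>A\<close> are lists: \<open>A\<^sup>*\<close> is \<^term>\<open>lists A\<close>, \<open>A\<^sup>n\<close> is \<open>words A n\<close>.
\<close>

definition words :: "'a set \<Rightarrow> nat \<Rightarrow> 'a list set" where
  "words A n = {w \<in> lists A. length w = n}"

definition subword :: "'a set \<Rightarrow> 'a list \<Rightarrow> 'a list \<Rightarrow> bool" where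
  "subword A y w \<longleftrightarrow> (\<exists>x\<in>lists A. \<exists>z\<in>lists A. w = x @ y @ z)"

definition word_system :: "'a set \<Rightarrow> (nat \<Rightarrow> 'a list set) \<Rightarrow> bool" where
  "word_system A X \<longleftrightarrow>
     (\<forall>n. X n \<subseteq> words A n) \<and>
     X 0 = words A 0 \<and>
     (\<forall>w\<in>(\<Union>n. X n). \<forall>k. \<forall>y\<in>words A k. subword A y w \<longrightarrow> y \<in> X k)"

text \<open>
  All levels \<open>X n\<close> of a Cartesian system live in one type, and the maps \<open>i m n\<close> are only
  constrained on \<open>X (m + n)\<close>. The canonical identification \<open>(U \<times> V) \<times> W = U \<times> V \<times> W\<close> is made
  explicit in the coassociativity condition.
\<close>

definition cartesian_system ::
    "(nat \<Rightarrow> 'b set) \<Rightarrow> 'b \<Rightarrow> (nat \<Rightarrow> nat \<Rightarrow> 'b \<Rightarrow> 'b \<times> 'b) \<Rightarrow> bool" where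
  "cartesian_system X e i \<longleftrightarrow>
     X 0 = {e} \<and>
     (\<forall>m n. i m n ` X (m + n) \<subseteq> X m \<times> X n \<and> inj_on (i m n) (X (m + n))) \<and>
     (\<forall>l m n. \<forall>x\<in>X (l + m + n).
        (\<lambda>((a, b), c). (a, b, c)) (map_prod (i l m) id (i (l + m) n x)) =
        map_prod id (i m n) (i l (m + n) x)) \<and>
     (\<forall>n. \<forall>x\<in>X n. i 0 n x = (e, x) \<and> i n 0 x = (x, e))"

definition cartesian_subsystem ::
    "(nat \<Rightarrow> 'b set) \<Rightarrow> (nat \<Rightarrow> 'b set) \<Rightarrow> 'b \<Rightarrow> (nat \<Rightarrow> nat \<Rightarrow> 'b \<Rightarrow> 'b \<times> 'b) \<Rightarrow> bool" where
  "cartesian_subsystem Y X e i \<longleftrightarrow>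
     cartesian_system X e i \<and>
     (\<forall>n. Y n \<subseteq> X n) \<and>
     Y 0 = X 0 \<and>
     (\<forall>m n. i m n ` Y (m + n) \<subseteq> Y m \<times> Y n)"

definition word_split :: "'a set \<Rightarrow> nat \<Rightarrow> nat \<Rightarrow> 'a list \<Rightarrow> 'a list \<times> 'a list" where
  "word_split A m n = inv_into (words A m \<times> words A n) (\<lambda>(x, y). x @ y)"

end

theory Submission
  imports Defs
begin

text \<open>
  Splitting a word of length \<open>m + n\<close> produces its prefix of length \<open>m\<close> and its suffix of length
  \<open>n\<close>, so a Cartesian subsystem is a family closed under prefixes and suffixes. This is the same
  as closure under subwords, since a subword is a prefix of a suffix.
\<close>

lemma words_0: "words A 0 = {[]}"
  by (auto simp: words_def)

lemma append_in_words: "x \<in> words A m \<Longrightarrow> y \<in> words A n \<Longrightarrow> x @ y \<in> words A (m + n)"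
  by (auto simp: words_def)

lemma take_in_words: "w \<in> words A (m + n) \<Longrightarrow> take m w \<in> words A m"
  by (auto simp: words_def dest: in_set_takeD)

lemma drop_in_words: "w \<in> words A (m + n) \<Longrightarrow> drop m w \<in> words A n"
  by (auto simp: words_def dest: in_set_dropD)

text \<open>The fixed length \<open>m\<close> of the left factor determines where to cut. Hence
  \<open>inv_into\<close> in \<open>word_split\<close> has only one preimage to choose.\<close>

lemma inj_on_append_words: "inj_on (\<lambda>(x, y). x @ y) (words A m \<times> words A n)"
  by (auto simp: inj_on_def words_def)

lemma word_split_append:
  assumes "x \<in> words A m" "y \<in> words A n"
  shows "word_split A m n (x @ y) = (x, y)"
  using inv_into_f_f[OF inj_on_append_words, of "(x, y)" A m n] assms
  by (simp add: word_split_def)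

text \<open>Trades the choice-based \<open>inv_into\<close> for an explicit cut, valid only on words
  that really are such concatenations.\<close>

lemma word_split_eq_take_drop:
  assumes "w \<in> words A (m + n)"
  shows "word_split A m n w = (take m w, drop m w)"
  using word_split_append[OF take_in_words[OF assms] drop_in_words[OF assms]] by simp

text \<open>Supplies the requirement on the ambient system contained in
  \<open>cartesian_subsystem\<close>.\<close>

lemma cartesian_system_words: "cartesian_system (words A) [] (word_split A)"
  unfolding cartesian_system_def
proof (intro conjI allI ballI)
  show "words A 0 = {[]}" by (rule words_0)
next
  fix m n
  show "word_split A m n ` words A (m + n) \<subseteq> words A m \<times> words A n"
    by (auto simp: word_split_eq_take_drop take_in_words drop_in_words)
  show "inj_on (word_split A m n) (words A (m + n))"
    by (rule inj_on_inverseI[where g = "\<lambda>(x, y). x @ y"]) (simp add: word_split_eq_take_drop)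
next
  fix l m n x
  assume x: "x \<in> words A (l + m + n)"
  then have x': "x \<in> words A (l + (m + n))" by (simp add: add.assoc)
  show "(\<lambda>((a, b), c). (a, b, c))
          (map_prod (word_split A l m) id (word_split A (l + m) n x)) =
        map_prod id (word_split A m n) (word_split A l (m + n) x)"
    \<comment> \<open>Both sides cut \<open>x\<close> at \<open>l\<close> and \<open>l + m\<close>;
      the middle pieces \<open>drop l (take (l + m) x)\<close> and \<open>take m (drop l x)\<close>
      agree by \<open>drop_take\<close>.\<close>
    by (simp add: word_split_eq_take_drop[OF x] word_split_eq_take_drop[OF x']
        word_split_eq_take_drop[OF take_in_words[OF x]]
        word_split_eq_take_drop[OF drop_in_words[OF x']] drop_take add.commute)
next
  fix n x
  assume "x \<in> words A n"
  moreover then have "length x = n" by (simp add: words_def)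
  ultimately show "word_split A 0 n x = ([], x)" "word_split A n 0 x = (x, [])"
    by (simp_all add: word_split_eq_take_drop)
qed

lemma word_system_split:
  assumes X: "word_system A X" and w: "w \<in> X (m + n)"
  shows "word_split A m n w \<in> X m \<times> X n"
proof -
  have closed: "y \<in> X k" if "y \<in> words A k" "subword A y w" for y k
    using X w that unfolding word_system_def by blast
  have wA: "w \<in> words A (m + n)"
    using X w unfolding word_system_def by blast
  have t: "take m w \<in> words A m" and d: "drop m w \<in> words A n"
    using wA by (rule take_in_words, rule drop_in_words)
  \<comment> \<open>An empty left or right context makes the prefix and the suffix subwords.\<close>
  have "w = [] @ take m w @ drop m w" "w = take m w @ drop m w @ []" by simp_all
  then have "subword A (take m w) w" "subword A (drop m w) w"
    using t d unfolding subword_def words_def by blast+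
  then show ?thesis
    using t d wA by (simp add: word_split_eq_take_drop closed)
qed

lemma subword_closed_if_split_closed:
  assumes XA: "\<And>n. X n \<subseteq> words A n"
    and split: "\<And>m n. word_split A m n ` X (m + n) \<subseteq> X m \<times> X n"
    and w: "w \<in> X n" and y: "y \<in> words A k" and sub: "subword A y w"
  shows "y \<in> X k"
proof -
  from sub obtain x z where xz: "x \<in> lists A" "z \<in> lists A" and w_eq: "w = x @ y @ z"
    unfolding subword_def by blast
  have x: "x \<in> words A (length x)" and z: "z \<in> words A (length z)"
    using xz by (simp_all add: words_def)
  \<comment> \<open>The level of \<open>w\<close> is its length. This bracketing fits the first cut,
    which removes \<open>x\<close> and leaves \<open>y @ z\<close> at level
    \<open>k + length z\<close>, ready for the second cut at \<open>k\<close>.\<close>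
  have n: "n = length x + (k + length z)"
    using w y XA[of n] by (auto simp: words_def w_eq)
  have "(x, y @ z) = word_split A (length x) (k + length z) w"
    unfolding w_eq by (rule word_split_append[OF x append_in_words[OF y z], symmetric])
  then have "y @ z \<in> X (k + length z)"
    using split[of "length x" "k + length z"] w unfolding n by force
  moreover have "word_split A k (length z) (y @ z) = (y, z)"
    using y z by (rule word_split_append)
  ultimately show ?thesis
    using split[of k "length z"] by force
qed

theorem theorem3p7:
  fixes A :: "'a set" and X :: "nat \<Rightarrow> 'a list set"
  assumes "\<And>n. X n \<subseteq> words A n"
  shows "word_system A X \<longleftrightarrow> cartesian_subsystem X (words A) [] (word_split A)"
proof
  assume X: "word_system A X"
  then have "X 0 = words A 0" by (simp add: word_system_def)
  then show "cartesian_subsystem X (words A) [] (word_split A)"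
    unfolding cartesian_subsystem_def
    using assms cartesian_system_words word_system_split[OF X] by blast
next
  assume "cartesian_subsystem X (words A) [] (word_split A)"
  then have X0: "X 0 = words A 0"
    and split: "\<And>m n. word_split A m n ` X (m + n) \<subseteq> X m \<times> X n"
    unfolding cartesian_subsystem_def by blast+
  show "word_system A X"
    unfolding word_system_def
    \<comment> \<open>The union over levels in \<open>word_system\<close> provides the level
      \<open>n\<close> of \<open>w\<close> for the lemma.\<close>
    using assms X0 by (blast intro: subword_closed_if_split_closed[OF assms split])
qed

end
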